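(* Let $M$ be a proper biharmonic submanifold in $\mathbb{S}^n$. If $M$ is of finite $k$-type, mass-symmetric and linearly independent, then $k=2$.
   Context: All manifolds are smooth and connected; $\mathbb{S}^n\subset\mathbb{R}^{n+1}$ is the unit sphere. Let $\varphi:M^m\to N$ be the inclusion of an $m$-dimensional submanifold in a Riemannian manifold $N$, with mean curvature vector field $H$ (so $mH$ is the trace of the second fundamental form). $M$ is biharmonic if $\Delta H+\operatorname{trace}R^N(d\varphi(\cdot),H)d\varphi(\cdot)=0$, where $\Delta V=-\operatorname{trace}\nabla^2V$ is the rough Laplacian on sections of $\varphi^{-1}(TN)$ and $R^N(X,Y)=[\nabla_X,\nabla_Y]-\nabla_{[X,Y]}$; it is proper biharmonic if it is biharmonic and not minimal ($H\not\equiv0$). (Here $N=\mathbb{S}^n$.) Finite type: a submanifold $M\subset\mathbb{R}^{n+1}$ with inclusion $\phi$ is of (finite) $k$-type if $\phi=\phi_0+\phi_{t_1}+\dots+\phi_{t_k}$ (the spectral decomposition), where $\phi_0\in\mathbb{R}^{n+1}$ is a constant vector, the $\phi_{t_i}:M\to\mathbb{R}^{n+1}$ are non-constant maps with $\Delta\phi_{t_i}=\lambda_{t_i}\phi_{t_i}$ ($\Delta=-\operatorname{trace}\nabla d$ the Laplacian of $M$, acting componentwise), and the real numbers $\lambda_{t_1},\dots,\lambda_{t_k}$ are mutually distinct. It is null finite type if some non-constant component is harmonic (some $\lambda_{t_i}=0$), non-null otherwise. A submanifold of $\mathbb{S}^n$ is of $k$-type if it is so as a submanifold of $\mathbb{R}^{n+1}$.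 A non-null finite type submanifold of $\mathbb{S}^n$ is mass-symmetric if $\phi_0=0$. A $k$-type submanifold is linearly independent if the subspaces $E_{t_i}=\operatorname{span}\{\phi_{t_i}(u):u\in M\}$, $i=1,\dots,k$, are linearly independent, i.e. the dimension of the span of $\bigcup_{i=1}^kE_{t_i}$ equals $\sum_{i=1}^k\dim E_{t_i}$. *)

theory Defs
  imports "HOL-Analysis.Analysis"
begin

text \<open>
  The sphere $S^n$ is \<open>sphere 0 1\<close> in \<open>real ^ 'n\<close>, where \<open>CARD('n) = n + 1\<close>.  A submanifold
  \<open>M\<close> of dimension \<open>m = CARD('m)\<close> is given by its manifold topology \<open>T\<close> on the set
  \<open>topspace T\<close> of points of \<open>real ^ 'n\<close>.  Everything on \<open>M\<close> is written in local
  parametrizations \<open>\<psi> : V \<rightarrow> M\<close>, \<open>V\<close> open in \<open>real ^ 'm\<close>; since the inclusion is the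
  identity, \<open>\<psi>\<close> is also the coordinate expression of the inclusion into \<open>real ^ 'n\<close>.
\<close>


subsection \<open>Smooth maps on open subsets of Euclidean space\<close>

definition pd :: "'m \<Rightarrow> (real ^ 'm \<Rightarrow> 'b::real_normed_vector) \<Rightarrow> real ^ 'm \<Rightarrow> 'b"
  where "pd i f u = frechet_derivative f (at u) (axis i 1)"

text \<open>For open \<open>V\<close> this is $C^\infty$: all iterated partial derivatives exist and are
  (totally) differentiable, hence continuous.\<close>

definition smooth :: "(real ^ 'm) set \<Rightarrow> (real ^ 'm \<Rightarrow> 'b::real_normed_vector) \<Rightarrow> bool"
  where "smooth V f \<longleftrightarrow> (\<forall>is. \<forall>u\<in>V. (foldr pd is f) differentiable (at u))"


subsection \<open>Submanifolds\<close>

definition local_param ::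
    "(real ^ 'n) topology \<Rightarrow> (real ^ 'm) set \<Rightarrow> (real ^ 'm \<Rightarrow> real ^ 'n) \<Rightarrow> bool"
  where "local_param T V \<psi> \<longleftrightarrow>
    open V \<and> smooth V \<psi> \<and> (\<forall>u\<in>V. inj (frechet_derivative \<psi> (at u))) \<and>
    openin T (\<psi> ` V) \<and> embedding_map (top_of_set V) T \<psi>"

text \<open>
  Connected immersed submanifolds.  The topology \<open>T\<close> may be finer than the subspace topology; the
  embedded submanifolds are those with \<open>T = top_of_set M\<close>.  No atlas has to be supplied:
  by the inverse function theorem the transition maps between local parametrizations are smooth,
  and the local parametrizations form the maximal atlas of the unique smooth structure for which
  the inclusion is an immersion.
\<close>

definition submanifold :: "'m::finite itself \<Rightarrow> (real ^ 'n) topology \<Rightarrow> bool"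
  where "submanifold _ T \<longleftrightarrow>
    connected_space T \<and> Hausdorff_space T \<and> second_countable T \<and>
    (\<forall>p\<in>topspace T. \<exists>V. \<exists>\<psi> :: real ^ 'm \<Rightarrow> real ^ 'n. local_param T V \<psi> \<and> p \<in> \<psi> ` V)"

definition sphere_submanifold :: "'m::finite itself \<Rightarrow> (real ^ 'n) topology \<Rightarrow> bool"
  where "sphere_submanifold m T \<longleftrightarrow> submanifold m T \<and> topspace T \<subseteq> sphere 0 1"

definition smooth_map_on ::
    "'m::finite itself \<Rightarrow> (real ^ 'n) topology \<Rightarrow> (real ^ 'n \<Rightarrow> 'b::real_normed_vector) \<Rightarrow> bool"
  where "smooth_map_on _ T f \<longleftrightarrow>
    (\<forall>V. \<forall>\<psi> :: real ^ 'm \<Rightarrow> real ^ 'n. local_param T V \<psi> \<longrightarrow> smooth V (f \<circ> \<psi>))"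


subsection \<open>Induced metric, Levi-Civita connection and Laplacian of a submanifold\<close>

definition gmat :: "(real ^ 'm \<Rightarrow> real ^ 'n) \<Rightarrow> real ^ 'm \<Rightarrow> real ^ 'm ^ 'm"
  where "gmat \<psi> u = (\<chi> i j. pd i \<psi> u \<bullet> pd j \<psi> u)"

definition ginv :: "(real ^ 'm \<Rightarrow> real ^ 'n) \<Rightarrow> real ^ 'm \<Rightarrow> real ^ 'm ^ 'm"
  where "ginv \<psi> u = matrix_inv (gmat \<psi> u)"

text \<open>\<open>christoffel \<psi> k i j u\<close> is $\Gamma^k_{ij}(u)$.\<close>

definition christoffel ::
    "(real ^ 'm \<Rightarrow> real ^ 'n) \<Rightarrow> 'm \<Rightarrow> 'm \<Rightarrow> 'm \<Rightarrow> real ^ 'm \<Rightarrow> real"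
  where "christoffel \<psi> k i j u = 1/2 * (\<Sum>l\<in>UNIV. ginv \<psi> u $ k $ l *
    (pd i (\<lambda>w. gmat \<psi> w $ j $ l) u + pd j (\<lambda>w. gmat \<psi> w $ i $ l) u
      - pd l (\<lambda>w. gmat \<psi> w $ i $ j) u))"

definition metric_trace ::
    "(real ^ 'm \<Rightarrow> real ^ 'n) \<Rightarrow> real ^ 'm \<Rightarrow> ('m \<Rightarrow> 'm \<Rightarrow> 'b::real_vector) \<Rightarrow> 'b"
  where "metric_trace \<psi> u b = (\<Sum>i\<in>UNIV. \<Sum>j\<in>UNIV. (ginv \<psi> u $ i $ j) *\<^sub>R b i j)"

text \<open>$\nabla df(\partial_i, \partial_j)$ and $\Delta f = -\mathrm{trace}\,\nabla df$; the argument
  \<open>f\<close> is the coordinate expression of a function on \<open>M\<close>.\<close>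

definition hess ::
    "(real ^ 'm \<Rightarrow> real ^ 'n) \<Rightarrow> (real ^ 'm \<Rightarrow> 'b::real_normed_vector) \<Rightarrow> 'm \<Rightarrow> 'm \<Rightarrow> real ^ 'm \<Rightarrow> 'b"
  where "hess \<psi> f i j u = pd i (pd j f) u - (\<Sum>k\<in>UNIV. christoffel \<psi> k i j u *\<^sub>R pd k f u)"

definition laplacian ::
    "(real ^ 'm \<Rightarrow> real ^ 'n) \<Rightarrow> (real ^ 'm \<Rightarrow> 'b::real_normed_vector) \<Rightarrow> real ^ 'm \<Rightarrow> 'b"
  where "laplacian \<psi> f u = - metric_trace \<psi> u (\<lambda>i j. hess \<psi> f i j u)"


subsection \<open>The Levi-Civita connection and the curvature of the unit sphere\<close>

text \<open>\<open>tproj p\<close> is the orthogonal projection onto the tangent space $p^\perp$ of the sphere.\<close>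

definition tproj :: "real ^ 'n \<Rightarrow> real ^ 'n \<Rightarrow> real ^ 'n"
  where "tproj p v = v - (p \<bullet> v) *\<^sub>R p"

text \<open>The derivative of a map defined on the sphere.  Vector fields are extended radially, so only
  their values on the sphere matter.\<close>

definition sphere_deriv :: "(real ^ 'n \<Rightarrow> real ^ 'n) \<Rightarrow> real ^ 'n \<Rightarrow> real ^ 'n \<Rightarrow> real ^ 'n"
  where "sphere_deriv Y p v = frechet_derivative (\<lambda>q. Y (q /\<^sub>R norm q)) (at p) v"

definition sphere_conn ::
    "(real ^ 'n \<Rightarrow> real ^ 'n) \<Rightarrow> (real ^ 'n \<Rightarrow> real ^ 'n) \<Rightarrow> real ^ 'n \<Rightarrow> real ^ 'n"
  where "sphere_conn X Y p = tproj p (sphere_deriv Y p (X p))"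

definition sphere_bracket ::
    "(real ^ 'n \<Rightarrow> real ^ 'n) \<Rightarrow> (real ^ 'n \<Rightarrow> real ^ 'n) \<Rightarrow> real ^ 'n \<Rightarrow> real ^ 'n"
  where "sphere_bracket X Y p = sphere_deriv Y p (X p) - sphere_deriv X p (Y p)"

definition sphere_curv_field ::
    "(real ^ 'n \<Rightarrow> real ^ 'n) \<Rightarrow> (real ^ 'n \<Rightarrow> real ^ 'n) \<Rightarrow> (real ^ 'n \<Rightarrow> real ^ 'n)
      \<Rightarrow> real ^ 'n \<Rightarrow> real ^ 'n"
  where "sphere_curv_field X Y Z p =
    sphere_conn X (sphere_conn Y Z) p - sphere_conn Y (sphere_conn X Z) p
      - sphere_conn (sphere_bracket X Y) Z p"

text \<open>The curvature tensor at \<open>p\<close>.  It does not depend on how the tangent vectors \<open>x\<close>, \<open>y\<close>,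
  \<open>z\<close> at \<open>p\<close> are extended to tangent fields; the extension used is \<open>q \<mapsto> tproj q x\<close>.\<close>

definition sphere_curv :: "real ^ 'n \<Rightarrow> real ^ 'n \<Rightarrow> real ^ 'n \<Rightarrow> real ^ 'n \<Rightarrow> real ^ 'n"
  where "sphere_curv p x y z =
    sphere_curv_field (\<lambda>q. tproj q x) (\<lambda>q. tproj q y) (\<lambda>q. tproj q z) p"

text \<open>\<open>sphere_conn\<close> is compatible with the metric and torsion-free.\<close>

lemma has_derivative_normalize:
  fixes p :: "real ^ 'n"
  assumes "p \<in> sphere 0 1"
  shows "((\<lambda>q. q /\<^sub>R norm q) has_derivative tproj p) (at p)"
proof -
  have n: "norm p = 1" "p \<noteq> 0" using assms by auto
  have sg: "sgn p = p" using n by (simp add: sgn_div_norm)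
  have "(norm has_derivative (\<lambda>h. h \<bullet> p)) (at p)"
    using has_derivative_norm[OF n(2)] sg by simp
  from has_derivative_scaleR[OF Deriv.has_derivative_inverse[OF _ this] has_derivative_ident] n
  show ?thesis
    by (simp add: tproj_def[abs_def] inner_commute)
qed

lemma sphere_deriv_inner:
  fixes Y Z :: "real ^ 'n \<Rightarrow> real ^ 'n"
  assumes p: "p \<in> sphere 0 1"
    and Y: "(\<lambda>q. Y (q /\<^sub>R norm q)) differentiable (at p)"
    and Z: "(\<lambda>q. Z (q /\<^sub>R norm q)) differentiable (at p)"
  shows "((\<lambda>q. Y (q /\<^sub>R norm q) \<bullet> Z (q /\<^sub>R norm q)) has_derivative
    (\<lambda>v. sphere_deriv Y p v \<bullet> Z p + Y p \<bullet> sphere_deriv Z p v)) (at p)"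
proof -
  have "((\<lambda>q. Y (q /\<^sub>R norm q)) has_derivative sphere_deriv Y p) (at p)"
       "((\<lambda>q. Z (q /\<^sub>R norm q)) has_derivative sphere_deriv Z p) (at p)"
    using Y Z by (simp_all add: sphere_deriv_def[abs_def] frechet_derivative_works[symmetric])
  from has_derivative_inner[OF this] show ?thesis
    using p by (simp add: add.commute)
qed

lemma sphere_conn_metric:
  fixes X Y Z :: "real ^ 'n \<Rightarrow> real ^ 'n"
  assumes p: "p \<in> sphere 0 1"
    and "(\<lambda>q. Y (q /\<^sub>R norm q)) differentiable (at p)"
    and "(\<lambda>q. Z (q /\<^sub>R norm q)) differentiable (at p)"
    and "p \<bullet> Y p = 0" "p \<bullet> Z p = 0"
  shows "frechet_derivative (\<lambda>q. Y (q /\<^sub>R norm q) \<bullet> Z (q /\<^sub>R norm q)) (at p) (X p) =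
    sphere_conn X Y p \<bullet> Z p + Y p \<bullet> sphere_conn X Z p"
  unfolding frechet_derivative_at[OF sphere_deriv_inner[OF assms(1-3)], symmetric]
  using assms(4,5)
  by (simp add: sphere_conn_def tproj_def inner_diff_left inner_diff_right inner_commute)

lemma sphere_deriv_radial:
  fixes Y :: "real ^ 'n \<Rightarrow> real ^ 'n"
  assumes p: "p \<in> sphere 0 1"
    and Y: "(\<lambda>q. Y (q /\<^sub>R norm q)) differentiable (at p)"
    and tan: "\<And>q. q \<in> sphere 0 1 \<Longrightarrow> q \<bullet> Y q = 0"
    and v: "p \<bullet> v = 0"
  shows "p \<bullet> sphere_deriv Y p v = - (v \<bullet> Y p)"
proof -
  have n: "norm p = 1" using p by simp
  have dY: "((\<lambda>q. Y (q /\<^sub>R norm q)) has_derivative sphere_deriv Y p) (at p)"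
    using Y by (simp add: sphere_deriv_def[abs_def] frechet_derivative_works[symmetric])
  have d1: "((\<lambda>q. (q /\<^sub>R norm q) \<bullet> Y (q /\<^sub>R norm q)) has_derivative
      (\<lambda>v. p \<bullet> sphere_deriv Y p v + tproj p v \<bullet> Y p)) (at p)"
    using has_derivative_inner[OF has_derivative_normalize[OF p] dY] n by simp
  have "(q /\<^sub>R norm q) \<bullet> Y (q /\<^sub>R norm q) = 0" for q
    by (cases "q = 0") (auto intro!: tan simp del: inner_scaleR_left)
  then have "((\<lambda>q. (q /\<^sub>R norm q) \<bullet> Y (q /\<^sub>R norm q)) has_derivative (\<lambda>v. 0)) (at p)"
    by (simp del: inner_scaleR_left)
  from fun_cong[OF has_derivative_unique[OF d1 this], of v] v show ?thesis
    by (simp add: tproj_def)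
qed

lemma sphere_conn_torsion_free:
  fixes X Y :: "real ^ 'n \<Rightarrow> real ^ 'n"
  assumes p: "p \<in> sphere 0 1"
    and X: "(\<lambda>q. X (q /\<^sub>R norm q)) differentiable (at p)"
    and Y: "(\<lambda>q. Y (q /\<^sub>R norm q)) differentiable (at p)"
    and tX: "\<And>q. q \<in> sphere 0 1 \<Longrightarrow> q \<bullet> X q = 0"
    and tY: "\<And>q. q \<in> sphere 0 1 \<Longrightarrow> q \<bullet> Y q = 0"
  shows "sphere_conn X Y p - sphere_conn Y X p = sphere_bracket X Y p"
  using sphere_deriv_radial[OF p X tX tY[OF p]] sphere_deriv_radial[OF p Y tY tX[OF p]]
  by (simp add: sphere_conn_def sphere_bracket_def tproj_def inner_commute)


subsection \<open>Mean curvature and biharmonicity of submanifolds of the sphere\<close>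

text \<open>The pull-back connection $\nabla_{\partial_i} W$ on sections \<open>W\<close> of $\varphi^{-1}(TS^n)$,
  where \<open>\<psi>\<close> takes values in the sphere.\<close>

definition cov ::
    "(real ^ 'm \<Rightarrow> real ^ 'n) \<Rightarrow> 'm \<Rightarrow> (real ^ 'm \<Rightarrow> real ^ 'n) \<Rightarrow> real ^ 'm \<Rightarrow> real ^ 'n"
  where "cov \<psi> i W u = tproj (\<psi> u) (pd i W u)"

text \<open>The defining property of the pull-back connection.\<close>

lemma cov_pullback:
  fixes \<psi> :: "real ^ 'm \<Rightarrow> real ^ 'n"
  assumes V: "open V" "u \<in> V" and sph: "\<psi> ` V \<subseteq> sphere 0 1"
    and d: "\<psi> differentiable (at u)"
    and Y: "(\<lambda>q. Y (q /\<^sub>R norm q)) differentiable (at (\<psi> u))"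
    and X: "X (\<psi> u) = pd i \<psi> u"
  shows "cov \<psi> i (Y \<circ> \<psi>) u = sphere_conn X Y (\<psi> u)"
proof -
  have "((\<lambda>q. Y (q /\<^sub>R norm q)) \<circ> \<psi> has_derivative
      sphere_deriv Y (\<psi> u) \<circ> frechet_derivative \<psi> (at u)) (at u)"
    using d Y by (intro diff_chain_at)
      (simp_all add: sphere_deriv_def[abs_def] frechet_derivative_works[symmetric])
  then have "(Y \<circ> \<psi> has_derivative sphere_deriv Y (\<psi> u) \<circ> frechet_derivative \<psi> (at u)) (at u)"
    by (rule has_derivative_transform_within_open[OF _ V]) (use sph in auto)
  from frechet_derivative_at[OF this, symmetric] show ?thesis
    using X by (simp add: cov_def sphere_conn_def pd_def)
qed

text \<open>The second fundamental form
  $B(\partial_i,\partial_j) = \nabla_{\partial_i} d\varphi(\partial_j) -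
   d\varphi(\nabla^M_{\partial_i}\partial_j)$.\<close>

definition second_ff ::
    "(real ^ 'm \<Rightarrow> real ^ 'n) \<Rightarrow> 'm \<Rightarrow> 'm \<Rightarrow> real ^ 'm \<Rightarrow> real ^ 'n"
  where "second_ff \<psi> i j u =
    cov \<psi> i (pd j \<psi>) u - (\<Sum>k\<in>UNIV. christoffel \<psi> k i j u *\<^sub>R pd k \<psi> u)"

definition mean_curv :: "(real ^ 'm \<Rightarrow> real ^ 'n) \<Rightarrow> real ^ 'm \<Rightarrow> real ^ 'n"
  where "mean_curv \<psi> u = metric_trace \<psi> u (\<lambda>i j. second_ff \<psi> i j u) /\<^sub>R real CARD('m)"

text \<open>$\nabla^2 W(\partial_i,\partial_j) =
  \nabla_{\partial_i}\nabla_{\partial_j} W - \nabla_{\nabla^M_{\partial_i}\partial_j} W$.\<close>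

definition cov2 ::
    "(real ^ 'm \<Rightarrow> real ^ 'n) \<Rightarrow> (real ^ 'm \<Rightarrow> real ^ 'n) \<Rightarrow> 'm \<Rightarrow> 'm \<Rightarrow> real ^ 'm \<Rightarrow> real ^ 'n"
  where "cov2 \<psi> W i j u =
    cov \<psi> i (cov \<psi> j W) u - (\<Sum>k\<in>UNIV. christoffel \<psi> k i j u *\<^sub>R cov \<psi> k W u)"

definition rough_laplacian ::
    "(real ^ 'm \<Rightarrow> real ^ 'n) \<Rightarrow> (real ^ 'm \<Rightarrow> real ^ 'n) \<Rightarrow> real ^ 'm \<Rightarrow> real ^ 'n"
  where "rough_laplacian \<psi> W u = - metric_trace \<psi> u (\<lambda>i j. cov2 \<psi> W i j u)"

definition biharmonic :: "'m::finite itself \<Rightarrow> (real ^ 'n) topology \<Rightarrow> bool"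
  where "biharmonic _ T \<longleftrightarrow>
    (\<forall>V. \<forall>\<psi> :: real ^ 'm \<Rightarrow> real ^ 'n. local_param T V \<psi> \<longrightarrow> (\<forall>u\<in>V.
      rough_laplacian \<psi> (mean_curv \<psi>) u
      + metric_trace \<psi> u (\<lambda>i j. sphere_curv (\<psi> u) (pd i \<psi> u) (mean_curv \<psi> u) (pd j \<psi> u)) = 0))"

definition minimal :: "'m::finite itself \<Rightarrow> (real ^ 'n) topology \<Rightarrow> bool"
  where "minimal _ T \<longleftrightarrow>
    (\<forall>V. \<forall>\<psi> :: real ^ 'm \<Rightarrow> real ^ 'n. local_param T V \<psi> \<longrightarrow> (\<forall>u\<in>V. mean_curv \<psi> u = 0))"

definition proper_biharmonic :: "'m::finite itself \<Rightarrow> (real ^ 'n) topology \<Rightarrow> bool"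
  where "proper_biharmonic m T \<longleftrightarrow> biharmonic m T \<and> \<not> minimal m T"


subsection \<open>Finite type submanifolds\<close>

definition eigenmap ::
    "'m::finite itself \<Rightarrow> (real ^ 'n) topology \<Rightarrow> real \<Rightarrow> (real ^ 'n \<Rightarrow> real ^ 'n) \<Rightarrow> bool"
  where "eigenmap m T \<mu> f \<longleftrightarrow> smooth_map_on m T f \<and>
    (\<forall>V. \<forall>\<psi> :: real ^ 'm \<Rightarrow> real ^ 'n. local_param T V \<psi> \<longrightarrow>
      (\<forall>u\<in>V. laplacian \<psi> (f \<circ> \<psi>) u = \<mu> *\<^sub>R f (\<psi> u)))"

text \<open>\<open>M\<close> is of \<open>k\<close>-type with spectral decomposition
  $\phi = \phi_0 + \phi_{t_1} + \dots + \phi_{t_k}$, where $\phi_{t_i}$ is \<open>\<phi> i\<close> with eigenvalue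
  \<open>\<mu> i\<close>.\<close>

definition k_type_decomposition ::
    "'m::finite itself \<Rightarrow> (real ^ 'n) topology \<Rightarrow> nat \<Rightarrow> real ^ 'n \<Rightarrow>
      (nat \<Rightarrow> real ^ 'n \<Rightarrow> real ^ 'n) \<Rightarrow> (nat \<Rightarrow> real) \<Rightarrow> bool"
  where "k_type_decomposition m T k \<phi>\<^sub>0 \<phi> \<mu> \<longleftrightarrow>
    (\<forall>p\<in>topspace T. p = \<phi>\<^sub>0 + (\<Sum>i=1..k. \<phi> i p)) \<and>
    (\<forall>i\<in>{1..k}. \<not> \<phi> i constant_on topspace T \<and> eigenmap m T (\<mu> i) (\<phi> i)) \<and>
    inj_on \<mu> {1..k}"

definition non_null :: "nat \<Rightarrow> (nat \<Rightarrow> real) \<Rightarrow> bool"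
  where "non_null k \<mu> \<longleftrightarrow> (\<forall>i\<in>{1..k}. \<mu> i \<noteq> 0)"

text \<open>For non-null finite type the constant part $\phi_0$ is determined by \<open>M\<close>.\<close>

definition mass_symmetric :: "nat \<Rightarrow> real ^ 'n \<Rightarrow> (nat \<Rightarrow> real) \<Rightarrow> bool"
  where "mass_symmetric k \<phi>\<^sub>0 \<mu> \<longleftrightarrow> non_null k \<mu> \<and> \<phi>\<^sub>0 = 0"

definition lin_indep_type ::
    "(real ^ 'n) topology \<Rightarrow> nat \<Rightarrow> (nat \<Rightarrow> real ^ 'n \<Rightarrow> real ^ 'n) \<Rightarrow> bool"
  where "lin_indep_type T k \<phi> \<longleftrightarrow>
    dim (span (\<Union>i\<in>{1..k}. span (\<phi> i ` topspace T))) =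
    (\<Sum>i=1..k. dim (span (\<phi> i ` topspace T)))"

end

theory Submission
  imports Defs
begin

text \<open>
  On $M \subset S^n$ we have $\Delta\phi = m(\phi - H)$.  Since $H$ is normal to $M$, the rough Laplacian of
  $H$ is the tangential part (with respect to the sphere) of the componentwise $\Delta H$, and the
  curvature term of the biharmonic equation is $-mH$.  So biharmonicity says that
  $\Delta H - mH$, or equivalently $\sum_i (\lambda_i - m)^2 \phi_i$, is normal to the sphere: at each
  point $p$ that sum equals $A(p)\,p$ with $p = \sum_i \phi_i(p)$.  By linear independence $(\lambda_i - m)^2 = A(p)$ whenever
  $\phi_i(p) \neq 0$; hence the continuous function $A$ has finite range and is constant by
  connectedness.  All $\lambda_i$ are then roots of one quadratic equation, so $k \le 2$, and $k = 1$
  would make $H$ a multiple of $\phi$, hence zero.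
\<close>


subsection \<open>Partial derivatives\<close>

lemma pd_cong:
  assumes "open V" "u \<in> V" "\<And>w. w \<in> V \<Longrightarrow> f w = g w"
  shows "pd i f u = pd i g u"
proof -
  \<comment> \<open>\<open>frechet_derivative\<close> is a choice among all derivatives, so it
    suffices that \<open>f\<close> and \<open>g\<close> admit the same ones; this also covers points
    without a derivative.\<close>
  have "(f has_derivative D) (at u) \<longleftrightarrow> (g has_derivative D) (at u)" for D
    using has_derivative_transform_within_open[OF _ assms(1,2), of f D UNIV g]
      has_derivative_transform_within_open[OF _ assms(1,2), of g D UNIV f] assms(3)
    by auto
  then show ?thesis
    by (simp add: pd_def frechet_derivative_def)
qed

lemma pd_eq: "(f has_derivative D) (at u) \<Longrightarrow> pd i f u = D (axis i 1)"
  by (simp add: pd_def frechet_derivative_at[symmetric])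

lemma differentiable_has_derivative:
  "f differentiable (at u) \<Longrightarrow> (f has_derivative frechet_derivative f (at u)) (at u)"
  by (simp add: frechet_derivative_works[symmetric])

lemma pd_inner:
  fixes f g :: "real ^ 'm \<Rightarrow> 'b::real_inner"
  assumes "f differentiable (at u)" "g differentiable (at u)"
  shows "pd i (\<lambda>w. f w \<bullet> g w) u = pd i f u \<bullet> g u + f u \<bullet> pd i g u"
  using pd_eq[OF has_derivative_inner[OF assms[THEN differentiable_has_derivative]], of i]
  by (simp add: pd_def)

lemma pd_const: "pd i (\<lambda>w. c) u = 0"
  by (simp add: pd_def)

lemma pd_sum_scaleR:
  fixes f :: "'i \<Rightarrow> real ^ 'm \<Rightarrow> 'b::real_normed_vector"
  assumes "\<And>i. i \<in> I \<Longrightarrow> f i differentiable (at u)"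
  shows "pd j (\<lambda>w. \<Sum>i\<in>I. c i *\<^sub>R f i w) u = (\<Sum>i\<in>I. c i *\<^sub>R pd j (f i) u)"
proof -
  have "((\<lambda>w. \<Sum>i\<in>I. c i *\<^sub>R f i w) has_derivative
      (\<lambda>h. \<Sum>i\<in>I. c i *\<^sub>R frechet_derivative (f i) (at u) h)) (at u)"
    by (intro has_derivative_sum has_derivative_scaleR_right differentiable_has_derivative assms)
  from pd_eq[OF this, of j] show ?thesis by (simp add: pd_def)
qed

lemma smoothD:
  assumes "smooth V f" "u \<in> V"
  shows "f differentiable (at u)"
  using assms unfolding smooth_def by (metis foldr_Nil id_apply)

lemma smooth_pd:
  assumes "smooth V f"
  shows "smooth V (pd i f)"
  unfolding smooth_def
proof (intro allI ballI)
  fix "is" u assume "u \<in> V"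
  then have "foldr pd (is @ [i]) f differentiable (at u)"
    using assms unfolding smooth_def by blast
  then show "foldr pd is (pd i f) differentiable (at u)" by simp
qed

text \<open>The second difference of \<open>f\<close> along \<open>a\<close> and \<open>b\<close>, divided by the squared step, has the limit
  \<open>D b\<close> by the mean value theorem in the direction \<open>a\<close>; it is symmetric in \<open>a\<close> and \<open>b\<close>.\<close>

lemma second_difference_limit:
  fixes f :: "'a::real_normed_vector \<Rightarrow> real"
  assumes V: "open V" "u \<in> V"
    and f: "\<And>w. w \<in> V \<Longrightarrow> (f has_derivative f' w) (at w)"
    and D: "((\<lambda>w. f' w a) has_derivative D) (at u)"
  shows "((\<lambda>h. (f (u + h *\<^sub>R a + h *\<^sub>R b) - f (u + h *\<^sub>R a) - f (u + h *\<^sub>R b) + f u) / h\<^sup>2)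
    \<longlongrightarrow> D b) (at_right 0)"
proof (rule tendstoI)
  fix e :: real assume e: "e > 0"
  define N where "N = norm a + norm b + 1"
  have N: "N > 0" by (simp add: N_def add_nonneg_pos)
  \<comment> \<open>Two remainders of size at most \<open>e' * (h * N)\<close> get added below; the
    factor 4 makes their sum at most \<open>h * (e / 2)\<close>.\<close>
  define e' where "e' = e / (4 * N)"
  have e': "e' > 0" using e N by (simp add: e'_def)
  obtain d1 where d1: "d1 > 0" "\<And>w. norm (w - u) < d1 \<Longrightarrow>
      norm (f' w a - f' u a - D (w - u)) \<le> e' * norm (w - u)"
    using D e' unfolding has_derivative_at_alt by blast
  obtain d2 where d2: "d2 > 0" "ball u d2 \<subseteq> V"
    using V openE by blast
  define d where "d = min d1 d2 / N"
  have d: "d > 0" using d1 d2 N by (simp add: d_def)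
  have lin: "linear D" using D has_derivative_linear by blast
  have "dist ((f (u + h *\<^sub>R a + h *\<^sub>R b) - f (u + h *\<^sub>R a) - f (u + h *\<^sub>R b) + f u) / h\<^sup>2) (D b) < e"
    if h: "0 < h" "h < d" for h
  proof -
    have small: "norm (t *\<^sub>R a + s *\<^sub>R b) \<le> h * N" "norm (t *\<^sub>R a + s *\<^sub>R b) < min d1 d2"
      if "0 \<le> t" "t \<le> h" "0 \<le> s" "s \<le> h" for t s
    proof -
      have "norm (t *\<^sub>R a + s *\<^sub>R b) \<le> norm (t *\<^sub>R a) + norm (s *\<^sub>R b)"
        by (rule norm_triangle_ineq)
      also have "\<dots> \<le> h * norm a + h * norm b"
        using that by (auto intro!: add_mono mult_right_mono)
      also have "\<dots> \<le> h * N" using h by (simp add: N_def algebra_simps)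
      finally show *: "norm (t *\<^sub>R a + s *\<^sub>R b) \<le> h * N" .
      also have "\<dots> < min d1 d2"
        using h N by (simp add: d_def pos_less_divide_eq)
      finally show "norm (t *\<^sub>R a + s *\<^sub>R b) < min d1 d2" .
    qed
    have inV: "u + t *\<^sub>R a + s *\<^sub>R b \<in> V" if "0 \<le> t" "t \<le> h" "0 \<le> s" "s \<le> h" for t s
    proof -
      have "dist u (u + t *\<^sub>R a + s *\<^sub>R b) = norm (t *\<^sub>R a + s *\<^sub>R b)"
        by (metis add.assoc add_diff_cancel_left' dist_commute dist_norm)
      then show ?thesis using small(2)[OF that] d2(2) by (auto simp: mem_ball)
    qed
    \<comment> \<open>The second difference is \<open>g h - g 0\<close>, an increment along
      \<open>a\<close> alone, so the mean value theorem in one variable applies.\<close>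
    define g where "g t = f (u + t *\<^sub>R a + h *\<^sub>R b) - f (u + t *\<^sub>R a)" for t :: real
    have dline: "((\<lambda>t. f (u + t *\<^sub>R a + s *\<^sub>R b)) has_real_derivative f' (u + t *\<^sub>R a + s *\<^sub>R b) a) (at t)"
      if "0 \<le> t" "t \<le> h" "0 \<le> s" "s \<le> h" for t s
    proof -
      have "((\<lambda>t. u + t *\<^sub>R a + s *\<^sub>R b) has_derivative (\<lambda>x. x *\<^sub>R a)) (at t)"
        by (auto intro!: derivative_eq_intros)
      from has_derivative_compose[OF this f[OF inV[OF that]]]
      have "((\<lambda>t. f (u + t *\<^sub>R a + s *\<^sub>R b)) has_derivative
          (\<lambda>x. f' (u + t *\<^sub>R a + s *\<^sub>R b) (x *\<^sub>R a))) (at t)" .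
      moreover have "linear (f' (u + t *\<^sub>R a + s *\<^sub>R b))"
        using f[OF inV[OF that]] has_derivative_linear by blast
      ultimately show ?thesis
        by (simp add: has_field_derivative_def linear_cmul mult.commute[of _ "f' _ a"] mult_commute_abs)
    qed
    have dg: "(g has_real_derivative f' (u + t *\<^sub>R a + h *\<^sub>R b) a - f' (u + t *\<^sub>R a) a) (at t)"
      if "0 \<le> t" "t \<le> h" for t
      unfolding g_def
      using dline[of t h] dline[of t 0] that h by (intro DERIV_diff) simp_all
    obtain z where z: "0 < z" "z < h"
      "g h - g 0 = (h - 0) * (f' (u + z *\<^sub>R a + h *\<^sub>R b) a - f' (u + z *\<^sub>R a) a)"
      using MVT2[of 0 h g "\<lambda>t. f' (u + t *\<^sub>R a + h *\<^sub>R b) a - f' (u + t *\<^sub>R a) a"] dg h by auto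
    \<comment> \<open>\<open>p\<close> and \<open>q\<close> are the remainders of the linear
      approximation of \<open>\<lambda>w. f' w a\<close> at \<open>u\<close>. Subtracting the two
      expansions cancels the contribution of the unknown intermediate point \<open>z\<close> and
      leaves \<open>h * D b\<close>.\<close>
    define p where "p = f' (u + z *\<^sub>R a + h *\<^sub>R b) a - f' u a - D (z *\<^sub>R a + h *\<^sub>R b)"
    define q where "q = f' (u + z *\<^sub>R a) a - f' u a - D (z *\<^sub>R a)"
    have p: "\<bar>p\<bar> \<le> e' * (h * N)"
    proof -
      have "\<bar>p\<bar> \<le> e' * norm (z *\<^sub>R a + h *\<^sub>R b)"
        using d1(2)[of "u + z *\<^sub>R a + h *\<^sub>R b"] small(2)[of z h] z h
        by (simp add: p_def add.assoc)
      also have "\<dots> \<le> e' * (h * N)" using small(1)[of z h] z h e' by (intro mult_left_mono) auto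
      finally show ?thesis .
    qed
    have q: "\<bar>q\<bar> \<le> e' * (h * N)"
    proof -
      have "\<bar>q\<bar> \<le> e' * norm (z *\<^sub>R a)"
        using d1(2)[of "u + z *\<^sub>R a"] small(2)[of z 0] z h
        by (simp add: q_def)
      also have "\<dots> \<le> e' * (h * N)" using small(1)[of z 0] z h e' by (intro mult_left_mono) auto
      finally show ?thesis .
    qed
    have "g h - g 0 = h * (p - q + h * D b)"
      using z(3) lin by (simp add: p_def q_def linear_add linear_cmul)
    then have "(g h - g 0) / h\<^sup>2 - D b = (p - q) / h"
      using h by (simp add: divide_simps power2_eq_square)
    moreover have "f (u + h *\<^sub>R a + h *\<^sub>R b) - f (u + h *\<^sub>R a) - f (u + h *\<^sub>R b) + f u = g h - g 0"
      by (simp add: g_def)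
    moreover have "\<bar>(p - q) / h\<bar> < e"
    proof -
      have "\<bar>p - q\<bar> \<le> 2 * (e' * (h * N))" using p q by linarith
      also have "\<dots> = h * (e / 2)" using N by (simp add: e'_def field_simps)
      also have "\<dots> < h * e" using h e by simp
      finally show ?thesis using h by (simp add: abs_divide pos_divide_less_eq mult.commute)
    qed
    ultimately show ?thesis by (simp add: dist_real_def)
  qed
  then show "\<forall>\<^sub>F h in at_right 0. dist ((f (u + h *\<^sub>R a + h *\<^sub>R b) - f (u + h *\<^sub>R a)
      - f (u + h *\<^sub>R b) + f u) / h\<^sup>2) (D b) < e"
    using d unfolding eventually_at_right_field by blast
qed

text \<open>The second difference is unchanged when its two directions are exchanged, so both
  iterated derivatives are limits of the same expression.\<close>

lemma pd_symmetric_real: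
  fixes f :: "real ^ 'm \<Rightarrow> real"
  assumes V: "open V" "u \<in> V" and f: "smooth V f"
  shows "pd i (pd j f) u = pd j (pd i f) u"
proof -
  have lim: "((\<lambda>h. (f (u + h *\<^sub>R axis j 1 + h *\<^sub>R axis i 1) - f (u + h *\<^sub>R axis j 1)
      - f (u + h *\<^sub>R axis i 1) + f u) / h\<^sup>2) \<longlongrightarrow> pd i (pd j f) u) (at_right 0)" for i j
    unfolding pd_def[of i "pd j f"]
  proof (rule second_difference_limit[OF V, of f "\<lambda>w. frechet_derivative f (at w)"])
    show "(f has_derivative frechet_derivative f (at w)) (at w)" if "w \<in> V" for w
      by (rule differentiable_has_derivative[OF smoothD[OF f that]])
    show "((\<lambda>w. frechet_derivative f (at w) (axis j 1)) has_derivative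
        frechet_derivative (pd j f) (at u)) (at u)"
      using differentiable_has_derivative[OF smoothD[OF smooth_pd[OF f] V(2)], of j]
      by (simp add: pd_def[abs_def])
  qed
  have "((\<lambda>h. (f (u + h *\<^sub>R axis j 1 + h *\<^sub>R axis i 1) - f (u + h *\<^sub>R axis j 1)
      - f (u + h *\<^sub>R axis i 1) + f u) / h\<^sup>2) \<longlongrightarrow> pd j (pd i f) u) (at_right 0)"
    using lim[of i j] by (simp add: algebra_simps)
  from tendsto_unique[OF _ lim this] show ?thesis by simp
qed

text \<open>Pairing with constant vectors reduces the symmetry of second derivatives of
  vector-valued maps to the real case.\<close>

lemma foldr_pd_inner_right:
  fixes f :: "real ^ 'm \<Rightarrow> 'b::real_inner"
  assumes V: "open V" and f: "smooth V f" and "u \<in> V"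
  shows "foldr pd is (\<lambda>w. f w \<bullet> c) u = foldr pd is f u \<bullet> c"
  using \<open>u \<in> V\<close>
proof (induction "is" arbitrary: u)
  case (Cons i "is")
  have "pd i (foldr pd is (\<lambda>w. f w \<bullet> c)) u = pd i (\<lambda>w. foldr pd is f w \<bullet> c) u"
    by (rule pd_cong[OF V Cons.prems Cons.IH])
  also have "\<dots> = pd i (foldr pd is f) u \<bullet> c"
    using f Cons.prems by (subst pd_inner) (auto simp: smooth_def pd_const)
  finally show ?case by simp
qed simp

lemma smooth_inner_right:
  fixes f :: "real ^ 'm \<Rightarrow> 'b::real_inner"
  assumes V: "open V" and f: "smooth V f"
  shows "smooth V (\<lambda>w. f w \<bullet> c)"
  unfolding smooth_def
proof (intro allI ballI)
  fix "is" u assume u: "u \<in> V"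
  have "(\<lambda>w. foldr pd is f w \<bullet> c) differentiable (at u)"
    using f u by (auto simp: smooth_def intro!: differentiable_inner)
  then obtain D where "((\<lambda>w. foldr pd is f w \<bullet> c) has_derivative D) (at u)"
    by (auto simp: differentiable_def)
  then have "(foldr pd is (\<lambda>w. f w \<bullet> c) has_derivative D) (at u)"
    by (rule has_derivative_transform_within_open[OF _ V u])
      (simp add: foldr_pd_inner_right[OF V f])
  then show "foldr pd is (\<lambda>w. f w \<bullet> c) differentiable (at u)"
    by (auto simp: differentiable_def)
qed

lemma pd_symmetric:
  fixes f :: "real ^ 'm \<Rightarrow> 'b::real_inner"
  assumes V: "open V" "u \<in> V" and f: "smooth V f"
  shows "pd i (pd j f) u = pd j (pd i f) u"
proof (rule vector_eq_rdot[THEN iffD1], rule allI)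
  fix c
  show "pd i (pd j f) u \<bullet> c = pd j (pd i f) u \<bullet> c"
    using foldr_pd_inner_right[OF V(1) f V(2), of "[i, j]" c]
      foldr_pd_inner_right[OF V(1) f V(2), of "[j, i]" c]
      pd_symmetric_real[OF V smooth_inner_right[OF V(1) f], of i j c]
    by simp
qed


subsection \<open>Curvature of the sphere\<close>

lemma tproj_linear: "linear (tproj p)"
  by (rule linearI) (simp_all add: tproj_def algebra_simps inner_add_right)

lemma tproj_tangent: "p \<bullet> v = 0 \<Longrightarrow> tproj p v = v"
  by (simp add: tproj_def)

lemma inner_tproj: "p \<in> sphere 0 1 \<Longrightarrow> p \<bullet> tproj p v = 0"
  by (simp add: tproj_def inner_diff_right norm_eq_1)

text \<open>Away from the origin the radial extension sees only values on the sphere, and the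
  complement of the origin is an open neighbourhood of \<open>p\<close>.\<close>

lemma sphere_deriv_cong:
  assumes p: "p \<in> sphere 0 1" and YZ: "\<And>q. q \<in> sphere 0 1 \<Longrightarrow> Y q = Z q"
  shows "sphere_deriv Y p = sphere_deriv Z p"
proof -
  have "p \<in> - {0}" "open (- {0::real^'n})" using p by auto
  moreover have "Y (q /\<^sub>R norm q) = Z (q /\<^sub>R norm q)" if "q \<in> - {0}" for q
    using that by (intro YZ) auto
  ultimately have "((\<lambda>q. Y (q /\<^sub>R norm q)) has_derivative D) (at p) \<longleftrightarrow>
      ((\<lambda>q. Z (q /\<^sub>R norm q)) has_derivative D) (at p)" for D
    by (metis (no_types, lifting) has_derivative_transform_within_open)
  then show ?thesis
    by (auto simp: sphere_deriv_def fun_eq_iff frechet_derivative_def)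
qed

lemma sphere_deriv_eq:
  "((\<lambda>q. Y (q /\<^sub>R norm q)) has_derivative D) (at p) \<Longrightarrow> sphere_deriv Y p = D"
  by (simp add: sphere_deriv_def[abs_def] frechet_derivative_at[symmetric])

lemma has_derivative_tproj_normalize:
  fixes p :: "real ^ 'n"
  assumes p: "p \<in> sphere 0 1"
  shows "((\<lambda>q. tproj (q /\<^sub>R norm q) z) has_derivative
    (\<lambda>v. - ((p \<bullet> z) *\<^sub>R tproj p v + (tproj p v \<bullet> z) *\<^sub>R p))) (at p)"
proof -
  have "norm p = 1" using p by simp
  then show ?thesis
    unfolding tproj_def[of "_ /\<^sub>R _"]
    using has_derivative_diff[OF has_derivative_const[of z]
      has_derivative_scaleR[OF has_derivative_inner_left[OF has_derivative_normalize[OF p], of z]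
      has_derivative_normalize[OF p]]]
    by (simp del: inner_scaleR_left)
qed

lemma sphere_deriv_tproj:
  fixes p :: "real ^ 'n"
  assumes p: "p \<in> sphere 0 1"
  shows "sphere_deriv (\<lambda>q. tproj q z) p v = - ((p \<bullet> z) *\<^sub>R tproj p v + (tproj p v \<bullet> z) *\<^sub>R p)"
  by (rule fun_cong[OF sphere_deriv_eq[OF has_derivative_tproj_normalize[OF p]]])

text \<open>The field \<open>\<lambda>q. tproj q z\<close> is the gradient on the sphere of the
  height function \<open>\<lambda>q. q \<bullet> z\<close>, whose Hessian is minus that function
  times the metric.\<close>

lemma sphere_conn_tproj:
  fixes p :: "real ^ 'n"
  assumes p: "p \<in> sphere 0 1"
  shows "sphere_conn (\<lambda>q. tproj q y) (\<lambda>q. tproj q z) p = - ((p \<bullet> z) *\<^sub>R tproj p y)"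
proof -
  have "tproj p p = 0" using p by (simp add: tproj_def norm_eq_1)
  then show ?thesis
    unfolding sphere_conn_def sphere_deriv_tproj[OF p]
    by (simp add: linear_neg[OF tproj_linear] linear_diff[OF tproj_linear]
        linear_cmul[OF tproj_linear] tproj_tangent inner_tproj[OF p])
qed

lemma sphere_conn_conn_tproj:
  fixes p :: "real ^ 'n"
  assumes p: "p \<in> sphere 0 1" and "p \<bullet> x = 0" "p \<bullet> y = 0" "p \<bullet> z = 0"
  shows "sphere_conn (\<lambda>q. tproj q x) (sphere_conn (\<lambda>q. tproj q y) (\<lambda>q. tproj q z)) p
    = - ((x \<bullet> z) *\<^sub>R y)"
proof -
  have n: "norm p = 1" using p by simp
  have "sphere_deriv (sphere_conn (\<lambda>q. tproj q y) (\<lambda>q. tproj q z)) p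
      = sphere_deriv (\<lambda>q. - ((q \<bullet> z) *\<^sub>R tproj q y)) p"
    by (intro sphere_deriv_cong p sphere_conn_tproj)
  \<comment> \<open>Since \<open>p \<bullet> z = 0\<close>, only the derivative of the scalar factor
    survives at \<open>p\<close>.\<close>
  moreover have "sphere_deriv (\<lambda>q. - ((q \<bullet> z) *\<^sub>R tproj q y)) p = (\<lambda>v. - ((tproj p v \<bullet> z) *\<^sub>R y))"
  proof (rule sphere_deriv_eq)
    from has_derivative_minus[OF has_derivative_scaleR[OF
        has_derivative_inner_left[OF has_derivative_normalize[OF p], of z]
        has_derivative_tproj_normalize[OF p, of y]]]
    show "((\<lambda>q. - (((q /\<^sub>R norm q) \<bullet> z) *\<^sub>R tproj (q /\<^sub>R norm q) y)) has_derivative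
        (\<lambda>v. - ((tproj p v \<bullet> z) *\<^sub>R y))) (at p)"
      using assms n by (simp del: inner_scaleR_left add: tproj_tangent)
  qed
  ultimately show ?thesis
    using assms by (simp add: sphere_conn_def tproj_tangent)
qed

text \<open>The bracket of the extended fields vanishes at \<open>p\<close>, so only the two second
  covariant derivatives remain; they form the curvature tensor of constant curvature 1.\<close>

lemma sphere_curv_eq:
  assumes p: "p \<in> sphere 0 1" and "p \<bullet> x = 0" "p \<bullet> y = 0" "p \<bullet> z = 0"
  shows "sphere_curv p x y z = (y \<bullet> z) *\<^sub>R x - (x \<bullet> z) *\<^sub>R y"
proof -
  \<comment> \<open>At \<open>p\<close> both terms of the bracket equal
    \<open>- ((x \<bullet> y) *\<^sub>R p)\<close>.\<close>
  have "sphere_bracket (\<lambda>q. tproj q x) (\<lambda>q. tproj q y) p = 0"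
    using assms by (simp add: sphere_bracket_def sphere_deriv_tproj[OF p] tproj_tangent inner_commute)
  then have "sphere_conn (sphere_bracket (\<lambda>q. tproj q x) (\<lambda>q. tproj q y)) (\<lambda>q. tproj q z) p = 0"
    unfolding sphere_conn_def sphere_deriv_tproj[OF p] by (simp add: tproj_def)
  then show ?thesis
    using assms by (simp add: sphere_curv_def sphere_curv_field_def sphere_conn_conn_tproj)
qed


subsection \<open>The mean curvature vector and the Laplacian of the inclusion\<close>

lemma metric_trace_linear:
  assumes "linear L"
  shows "metric_trace \<psi> u (\<lambda>i j. L (b i j)) = L (metric_trace \<psi> u b)"
  by (simp add: metric_trace_def linear_sum[OF assms] linear_cmul[OF assms])

lemma metric_trace_add:
  "metric_trace \<psi> u (\<lambda>i j. a i j + b i j) = metric_trace \<psi> u a + metric_trace \<psi> u b"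
  by (simp add: metric_trace_def scaleR_add_right sum.distrib)

lemma metric_trace_sum_scaleR:
  "metric_trace \<psi> u (\<lambda>i j. \<Sum>t\<in>I. c t *\<^sub>R b t i j) = (\<Sum>t\<in>I. c t *\<^sub>R metric_trace \<psi> u (b t))"
proof (induction I rule: infinite_finite_induct)
  case (insert t I)
  then show ?case
    by (simp add: metric_trace_add metric_trace_linear[of "\<lambda>x. c t *\<^sub>R x"] linear_scaleR)
qed (simp_all add: metric_trace_def)

lemma pd_pd_cong:
  assumes "open V" "u \<in> V" "\<And>w. w \<in> V \<Longrightarrow> f w = g w"
  shows "pd i (pd j f) u = pd i (pd j g) u"
  using assms by (intro pd_cong[of V]) (auto intro: pd_cong)

lemma laplacian_cong:
  assumes "open V" "u \<in> V" "\<And>w. w \<in> V \<Longrightarrow> f w = g w"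
  shows "laplacian \<psi> f u = laplacian \<psi> g u"
  using pd_cong[OF assms] pd_pd_cong[OF assms] by (simp add: laplacian_def hess_def)

lemma pd_pd_sum_scaleR:
  fixes f :: "'i \<Rightarrow> real ^ 'm \<Rightarrow> 'b::real_normed_vector"
  assumes V: "open V" "u \<in> V" and f: "\<And>t. t \<in> I \<Longrightarrow> smooth V (f t)"
  shows "pd i (pd j (\<lambda>w. \<Sum>t\<in>I. c t *\<^sub>R f t w)) u = (\<Sum>t\<in>I. c t *\<^sub>R pd i (pd j (f t)) u)"
proof -
  have "pd i (pd j (\<lambda>w. \<Sum>t\<in>I. c t *\<^sub>R f t w)) u = pd i (\<lambda>w. \<Sum>t\<in>I. c t *\<^sub>R pd j (f t) w) u"
    by (rule pd_cong[OF V]) (auto intro!: pd_sum_scaleR smoothD[OF f])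
  also have "\<dots> = (\<Sum>t\<in>I. c t *\<^sub>R pd i (pd j (f t)) u)"
    by (intro pd_sum_scaleR smoothD[OF smooth_pd[OF f]] V)
  finally show ?thesis .
qed

lemma hess_sum_scaleR:
  fixes f :: "'i \<Rightarrow> real ^ 'm \<Rightarrow> 'b::real_normed_vector"
  assumes V: "open V" "u \<in> V" and f: "\<And>t. t \<in> I \<Longrightarrow> smooth V (f t)"
  shows "hess \<psi> (\<lambda>w. \<Sum>t\<in>I. c t *\<^sub>R f t w) i j u = (\<Sum>t\<in>I. c t *\<^sub>R hess \<psi> (f t) i j u)"
proof -
  have "(\<Sum>k\<in>UNIV. christoffel \<psi> k i j u *\<^sub>R (\<Sum>t\<in>I. c t *\<^sub>R pd k (f t) u))
      = (\<Sum>t\<in>I. c t *\<^sub>R (\<Sum>k\<in>UNIV. christoffel \<psi> k i j u *\<^sub>R pd k (f t) u))"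
    by (simp add: scaleR_sum_right mult.commute) (rule sum.swap)
  moreover have "pd k (\<lambda>w. \<Sum>t\<in>I. c t *\<^sub>R f t w) u = (\<Sum>t\<in>I. c t *\<^sub>R pd k (f t) u)" for k
    by (intro pd_sum_scaleR smoothD[OF f] V)
  ultimately show ?thesis
    by (simp add: hess_def pd_pd_sum_scaleR[OF V f] scaleR_diff_right sum_subtractf)
qed

lemma laplacian_sum_scaleR:
  fixes f :: "'i \<Rightarrow> real ^ 'm \<Rightarrow> 'b::real_normed_vector"
  assumes V: "open V" "u \<in> V" and f: "\<And>t. t \<in> I \<Longrightarrow> smooth V (f t)"
  shows "laplacian \<psi> (\<lambda>w. \<Sum>t\<in>I. c t *\<^sub>R f t w) u = (\<Sum>t\<in>I. c t *\<^sub>R laplacian \<psi> (f t) u)"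
  by (simp add: laplacian_def hess_sum_scaleR[OF V f] metric_trace_sum_scaleR sum_negf)

section \<open>Geometry of one parametrization with values in the unit sphere\<close>

locale sphere_chart =
  fixes V :: "(real ^ 'm) set" and \<psi> :: "real ^ 'm \<Rightarrow> real ^ 'n"
  assumes open_V: "open V"
    and smooth_psi: "smooth V \<psi>"
    and immersion: "\<And>u. u \<in> V \<Longrightarrow> inj (frechet_derivative \<psi> (at u))"
    and in_sphere: "\<And>u. u \<in> V \<Longrightarrow> \<psi> u \<in> sphere 0 1"
begin

lemma inner_self: "u \<in> V \<Longrightarrow> \<psi> u \<bullet> \<psi> u = 1"
  using in_sphere by (simp add: norm_eq_1)

text \<open>Product rule for the vanishing function \<open>\<psi> \<bullet> h\<close>. It serves for
  the coordinate fields and for fields normal to M, whose derivatives then stay tangent to the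
  sphere.\<close>

lemma orthogonal_pd:
  assumes h: "\<And>w. w \<in> V \<Longrightarrow> h differentiable (at w)" "\<And>w. w \<in> V \<Longrightarrow> \<psi> w \<bullet> h w = 0"
    and u: "u \<in> V"
  shows "\<psi> u \<bullet> pd i h u = - (pd i \<psi> u \<bullet> h u)"
proof -
  have "pd i (\<lambda>w. \<psi> w \<bullet> h w) u = pd i (\<lambda>w. 0) u"
    by (rule pd_cong[OF open_V u]) (rule h(2))
  then show ?thesis
    by (simp add: pd_inner[OF smoothD[OF smooth_psi u] h(1)[OF u]] pd_const)
qed

lemma psi_orthogonal_pd:
  assumes u: "u \<in> V"
  shows "\<psi> u \<bullet> pd i \<psi> u = 0"
proof -
  have "pd i (\<lambda>w. \<psi> w \<bullet> \<psi> w) u = pd i (\<lambda>w. 1) u"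
    by (rule pd_cong[OF open_V u]) (rule inner_self)
  then show ?thesis
    by (simp add: pd_inner[OF smoothD[OF smooth_psi u] smoothD[OF smooth_psi u]] pd_const
        inner_commute)
qed

text \<open>Apply \<open>orthogonal_pd\<close> to the coordinate field \<open>pd j \<psi>\<close>.
  The result is the second fundamental form of the sphere itself.\<close>

lemma psi_inner_pd_pd:
  assumes u: "u \<in> V"
  shows "\<psi> u \<bullet> pd i (pd j \<psi>) u = - gmat \<psi> u $ i $ j"
  using orthogonal_pd[OF smoothD[OF smooth_pd[OF smooth_psi]] psi_orthogonal_pd u]
  by (simp add: gmat_def)

lemma gmat_sym: "gmat \<psi> u $ i $ j = gmat \<psi> u $ j $ i"
  by (simp add: gmat_def inner_commute)

text \<open>The metric is the Gram matrix of the partial derivatives, so the differential sends a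
  kernel vector to a vector of length zero; injectivity of the differential does the rest.\<close>

lemma invertible_gmat:
  assumes u: "u \<in> V"
  shows "invertible (gmat \<psi> u)"
proof -
  have lin: "linear (frechet_derivative \<psi> (at u))"
    by (rule has_derivative_linear[OF differentiable_has_derivative[OF smoothD[OF smooth_psi u]]])
  have D: "frechet_derivative \<psi> (at u) x = (\<Sum>i\<in>UNIV. x $ i *\<^sub>R pd i \<psi> u)" for x
  proof -
    have "frechet_derivative \<psi> (at u) (\<Sum>i\<in>UNIV. x $ i *\<^sub>R axis i 1)
        = (\<Sum>i\<in>UNIV. x $ i *\<^sub>R pd i \<psi> u)"
      by (simp add: linear_sum[OF lin] linear_cmul[OF lin] pd_def)
    then show ?thesis
      using basis_expansion[of x] by (simp add: scalar_mult_eq_scaleR)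
  qed
  have "x = 0" if "gmat \<psi> u *v x = 0" for x
  proof -
    let ?D = "frechet_derivative \<psi> (at u) x"
    have "pd i \<psi> u \<bullet> ?D = (gmat \<psi> u *v x) $ i" for i
      by (simp add: D matrix_vector_mult_def gmat_def inner_sum_right mult.commute)
    then have "?D \<bullet> ?D = 0"
      using that by (subst (1) D) (simp add: inner_sum_left)
    then show ?thesis
      using immersion[OF u] lin by (metis injD inner_eq_zero_iff linear_0)
  qed
  then show ?thesis
    using invertible_left_inverse matrix_left_invertible_ker by blast
qed

lemma gmat_ginv: "u \<in> V \<Longrightarrow> gmat \<psi> u ** ginv \<psi> u = mat 1"
  and ginv_gmat: "u \<in> V \<Longrightarrow> ginv \<psi> u ** gmat \<psi> u = mat 1"
  using someI_ex[OF invertible_gmat[unfolded invertible_def]]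
  by (simp_all add: ginv_def matrix_inv_def)

lemma metric_trace_gmat:
  assumes u: "u \<in> V"
  shows "metric_trace \<psi> u (\<lambda>i j. gmat \<psi> u $ i $ j *\<^sub>R x) = real CARD('m) *\<^sub>R x"
proof -
  have "(\<Sum>j\<in>UNIV. ginv \<psi> u $ i $ j * gmat \<psi> u $ i $ j) = (ginv \<psi> u ** gmat \<psi> u) $ i $ i" for i
    by (simp add: matrix_matrix_mult_def gmat_sym[of u i])
  then have "(\<Sum>j\<in>UNIV. ginv \<psi> u $ i $ j * gmat \<psi> u $ i $ j) = 1" for i
    by (simp add: ginv_gmat[OF u] mat_def)
  then show ?thesis
    by (simp add: metric_trace_def scaleR_sum_left[symmetric] sum_constant_scaleR)
qed

text \<open>This identifies the Christoffel sum as the part of the second derivative tangent to M.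
  In the Koszul combination of metric derivatives, symmetry of second derivatives cancels everything
  except two equal terms.\<close>

lemma christoffel_pd_inner_pd:
  assumes u: "u \<in> V"
  shows "(\<Sum>k\<in>UNIV. christoffel \<psi> k i j u *\<^sub>R pd k \<psi> u) \<bullet> pd l \<psi> u = pd i (pd j \<psi>) u \<bullet> pd l \<psi> u"
proof -
  \<comment> \<open>Twice the Christoffel symbols of the first kind, before the index is raised with
    \<open>ginv\<close>.\<close>
  define s where "s = (\<chi> l. pd i (\<lambda>w. gmat \<psi> w $ j $ l) u + pd j (\<lambda>w. gmat \<psi> w $ i $ l) u
      - pd l (\<lambda>w. gmat \<psi> w $ i $ j) u)"
  have dg: "pd a (\<lambda>w. gmat \<psi> w $ b $ c) u
      = pd a (pd b \<psi>) u \<bullet> pd c \<psi> u + pd b \<psi> u \<bullet> pd a (pd c \<psi>) u" for a b c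
    by (simp add: gmat_def pd_inner[OF smoothD[OF smooth_pd[OF smooth_psi] u]
        smoothD[OF smooth_pd[OF smooth_psi] u]])
  have s: "s $ l = 2 * (pd i (pd j \<psi>) u \<bullet> pd l \<psi> u)"
    using pd_symmetric[OF open_V u smooth_psi, of i j] pd_symmetric[OF open_V u smooth_psi, of i l]
      pd_symmetric[OF open_V u smooth_psi, of j l]
    by (simp add: s_def dg inner_commute)
  have "christoffel \<psi> k i j u = 1/2 * (ginv \<psi> u *v s) $ k" for k
    by (simp add: christoffel_def s_def matrix_vector_mult_def)
  then have "(\<Sum>k\<in>UNIV. christoffel \<psi> k i j u *\<^sub>R pd k \<psi> u) \<bullet> pd l \<psi> u
      = (\<Sum>k\<in>UNIV. 1/2 * (gmat \<psi> u $ l $ k * (ginv \<psi> u *v s) $ k))"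
    unfolding inner_sum_left by (intro sum.cong) (simp_all add: gmat_def inner_commute)
  also have "\<dots> = 1/2 * (gmat \<psi> u *v (ginv \<psi> u *v s)) $ l"
    unfolding sum_distrib_left[symmetric] by (simp add: matrix_vector_mult_def[of "gmat \<psi> u"])
  finally have "(\<Sum>k\<in>UNIV. christoffel \<psi> k i j u *\<^sub>R pd k \<psi> u) \<bullet> pd l \<psi> u = 1/2 * s $ l"
    by (simp add: matrix_vector_mul_assoc gmat_ginv[OF u])
  then show ?thesis by (simp add: s)
qed

lemma second_ff_orthogonal:
  assumes u: "u \<in> V"
  shows "second_ff \<psi> i j u \<bullet> pd l \<psi> u = 0" "\<psi> u \<bullet> second_ff \<psi> i j u = 0"
  using psi_orthogonal_pd[OF u] christoffel_pd_inner_pd[OF u] inner_tproj[OF in_sphere[OF u]]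
  by (simp_all add: second_ff_def cov_def tproj_def inner_diff_left inner_diff_right
      inner_sum_right inner_self[OF u])

lemma mean_curv_orthogonal:
  assumes u: "u \<in> V"
  shows "pd l \<psi> u \<bullet> mean_curv \<psi> u = 0" "\<psi> u \<bullet> mean_curv \<psi> u = 0"
  using second_ff_orthogonal[OF u]
  by (simp_all add: mean_curv_def metric_trace_def inner_sum_right inner_commute)

lemma second_ff_eq:
  assumes u: "u \<in> V"
  shows "second_ff \<psi> i j u = hess \<psi> \<psi> i j u + gmat \<psi> u $ i $ j *\<^sub>R \<psi> u"
  by (simp add: second_ff_def hess_def cov_def tproj_def psi_inner_pd_pd[OF u])

text \<open>Beltrami's formula in the sphere: trace \<open>second_ff_eq\<close> and use that the
  metric has trace m.\<close>

lemma mean_curv_eq: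
  assumes u: "u \<in> V"
  shows "mean_curv \<psi> u = \<psi> u - (1 / real CARD('m)) *\<^sub>R laplacian \<psi> \<psi> u"
  by (simp add: mean_curv_def laplacian_def second_ff_eq[OF u] metric_trace_add
      metric_trace_gmat[OF u] scaleR_add_right inverse_eq_divide)

text \<open>The field is normal to M and tangent to the sphere, so by \<open>orthogonal_pd\<close>
  its first derivatives need no projection and only the outer projection survives. \<open>W\<close>
  and \<open>h\<close> are kept apart because \<open>mean_curv\<close> agrees only on
  \<open>V\<close> with the spectral sum, whose differentiability is evident.\<close>

lemma rough_laplacian_normal:
  assumes u: "u \<in> V" and h: "\<And>w. w \<in> V \<Longrightarrow> h differentiable (at w)"
    and W: "\<And>w. w \<in> V \<Longrightarrow> W w = h w"
    and orth: "\<And>w. w \<in> V \<Longrightarrow> \<psi> w \<bullet> h w = 0" "\<And>w i. w \<in> V \<Longrightarrow> pd i \<psi> w \<bullet> h w = 0"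
  shows "rough_laplacian \<psi> W u = tproj (\<psi> u) (laplacian \<psi> h u)"
proof -
  have cov: "cov \<psi> i W w = pd i h w" if w: "w \<in> V" for i w
  proof -
    have "\<psi> w \<bullet> pd i h w = 0"
      using orthogonal_pd[OF h orth(1) w] orth(2)[OF w] by simp
    moreover have "pd i W w = pd i h w"
      by (rule pd_cong[OF open_V w W])
    ultimately show ?thesis by (simp add: cov_def tproj_tangent)
  qed
  have "cov2 \<psi> W i j u = tproj (\<psi> u) (hess \<psi> h i j u)" for i j
  proof -
    have "pd i (cov \<psi> j W) u = pd i (pd j h) u"
      by (rule pd_cong[OF open_V u cov])
    then have "cov \<psi> i (cov \<psi> j W) u = tproj (\<psi> u) (pd i (pd j h) u)"
      by (simp add: cov_def)
    moreover have "tproj (\<psi> u) (pd k h u) = pd k h u" for k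
      using orthogonal_pd[OF h orth(1) u] orth(2)[OF u] by (simp add: tproj_tangent)
    ultimately show ?thesis
      by (simp add: cov2_def hess_def cov[OF u] linear_diff[OF tproj_linear]
          linear_sum[OF tproj_linear] linear_cmul[OF tproj_linear])
  qed
  then show ?thesis
    by (simp add: rough_laplacian_def laplacian_def metric_trace_linear[OF tproj_linear]
        linear_neg[OF tproj_linear])
qed

text \<open>H is normal to M, so one of the two terms of the constant curvature formula drops out
  and the other is minus the metric times H.\<close>

lemma metric_trace_sphere_curv:
  assumes u: "u \<in> V"
  shows "metric_trace \<psi> u (\<lambda>i j. sphere_curv (\<psi> u) (pd i \<psi> u) (mean_curv \<psi> u) (pd j \<psi> u))
    = - (real CARD('m) *\<^sub>R mean_curv \<psi> u)"
proof -
  have "sphere_curv (\<psi> u) (pd i \<psi> u) (mean_curv \<psi> u) (pd j \<psi> u)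
      = gmat \<psi> u $ i $ j *\<^sub>R (- mean_curv \<psi> u)" for i j
    using mean_curv_orthogonal[OF u]
    by (subst sphere_curv_eq[OF in_sphere[OF u]])
      (simp_all add: psi_orthogonal_pd[OF u] gmat_def inner_commute)
  then show ?thesis
    by (simp only: metric_trace_gmat[OF u]) simp
qed

section \<open>Spectral decomposition in one parametrization\<close>

context
  fixes I :: "'i set" and f :: "'i \<Rightarrow> real ^ 'm \<Rightarrow> real ^ 'n" and \<mu> :: "'i \<Rightarrow> real"
  assumes smooth_f: "\<And>t. t \<in> I \<Longrightarrow> smooth V (f t)"
    and eigen: "\<And>t u. t \<in> I \<Longrightarrow> u \<in> V \<Longrightarrow> laplacian \<psi> (f t) u = \<mu> t *\<^sub>R f t u"
    and psi_sum: "\<And>u. u \<in> V \<Longrightarrow> \<psi> u = (\<Sum>t\<in>I. f t u)"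
begin

lemma mean_curv_eigen:
  assumes u: "u \<in> V"
  shows "mean_curv \<psi> u = (\<Sum>t\<in>I. (1 - \<mu> t / CARD('m)) *\<^sub>R f t u)"
proof -
  have "laplacian \<psi> \<psi> u = laplacian \<psi> (\<lambda>w. \<Sum>t\<in>I. 1 *\<^sub>R f t w) u"
    by (rule laplacian_cong[OF open_V u]) (simp add: psi_sum)
  also have "\<dots> = (\<Sum>t\<in>I. \<mu> t *\<^sub>R f t u)"
    by (subst laplacian_sum_scaleR[OF open_V u smooth_f]) (simp_all add: eigen u)
  finally have "mean_curv \<psi> u = \<psi> u - (1 / CARD('m)) *\<^sub>R (\<Sum>t\<in>I. \<mu> t *\<^sub>R f t u)"
    by (simp only: mean_curv_eq[OF u])
  also have "\<dots> = (\<Sum>t\<in>I. f t u) - (\<Sum>t\<in>I. (\<mu> t / CARD('m)) *\<^sub>R f t u)"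
    unfolding scaleR_sum_right psi_sum[OF u] by simp
  finally show ?thesis
    by (simp only: scaleR_diff_left sum_subtractf scaleR_one)
qed

text \<open>In the spectral sum for H the coefficient is \<open>- (\<mu> t - m) / m\<close>, and
  applying Delta - m multiplies it by \<open>\<mu> t - m\<close>; this produces the square. The term
  m H may be moved inside the projection because H is tangent to the sphere.\<close>

lemma biharmonic_eigen:
  assumes u: "u \<in> V"
    and bih: "rough_laplacian \<psi> (mean_curv \<psi>) u + metric_trace \<psi> u
      (\<lambda>i j. sphere_curv (\<psi> u) (pd i \<psi> u) (mean_curv \<psi> u) (pd j \<psi> u)) = 0"
  shows "tproj (\<psi> u) (\<Sum>t\<in>I. (\<mu> t - CARD('m))\<^sup>2 *\<^sub>R f t u) = 0"
proof -
  define m where "m = real CARD('m)"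
  have m: "m \<noteq> 0" by (simp add: m_def)
  define c where "c t = 1 - \<mu> t / m" for t
  define h where "h = (\<lambda>u. \<Sum>t\<in>I. c t *\<^sub>R f t u)"
  have H: "mean_curv \<psi> w = h w" if "w \<in> V" for w
    using mean_curv_eigen[OF that] by (simp add: h_def c_def m_def)
  have "laplacian \<psi> h u = (\<Sum>t\<in>I. c t *\<^sub>R (\<mu> t *\<^sub>R f t u))"
    unfolding h_def by (subst laplacian_sum_scaleR[OF open_V u smooth_f]) (simp_all add: eigen u)
  then have "laplacian \<psi> h u - m *\<^sub>R h u = (\<Sum>t\<in>I. (c t * \<mu> t - m * c t) *\<^sub>R f t u)"
    by (simp add: h_def scaleR_sum_right sum_subtractf scaleR_diff_left)
  also have "\<dots> = (\<Sum>t\<in>I. (- 1 / m) *\<^sub>R ((\<mu> t - m)\<^sup>2 *\<^sub>R f t u))"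
  proof (intro sum.cong refl)
    fix t
    have "c t * \<mu> t - m * c t = (- 1 / m) * (\<mu> t - m)\<^sup>2"
      using m by (simp add: c_def field_simps power2_eq_square)
    then show "(c t * \<mu> t - m * c t) *\<^sub>R f t u = (- 1 / m) *\<^sub>R ((\<mu> t - m)\<^sup>2 *\<^sub>R f t u)"
      by simp
  qed
  finally have *: "laplacian \<psi> h u - m *\<^sub>R h u = (- 1 / m) *\<^sub>R (\<Sum>t\<in>I. (\<mu> t - m)\<^sup>2 *\<^sub>R f t u)"
    by (simp only: scaleR_sum_right)
  have "h differentiable (at w)" if "w \<in> V" for w
  proof (rule differentiableI)
    show "(h has_derivative (\<lambda>v. \<Sum>t\<in>I. c t *\<^sub>R frechet_derivative (f t) (at w) v)) (at w)"
      unfolding h_def by (intro has_derivative_sum has_derivative_scaleR_right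
          differentiable_has_derivative smoothD[OF smooth_f that])
  qed
  then have "rough_laplacian \<psi> (mean_curv \<psi>) u = tproj (\<psi> u) (laplacian \<psi> h u)"
    using rough_laplacian_normal[OF u _ H] mean_curv_orthogonal H by simp
  moreover have "tproj (\<psi> u) (m *\<^sub>R h u) = m *\<^sub>R h u"
    using mean_curv_orthogonal(2)[OF u] by (intro tproj_tangent) (simp add: H[OF u])
  ultimately have "tproj (\<psi> u) (laplacian \<psi> h u - m *\<^sub>R h u) = 0"
    using bih unfolding metric_trace_sphere_curv[OF u] linear_diff[OF tproj_linear]
    by (simp add: m_def H[OF u])
  then show ?thesis
    unfolding * linear_cmul[OF tproj_linear] using m by (simp add: m_def)
qed

end

end


lemma sphere_chart_local_param:
  assumes "local_param T V \<psi>" "topspace T \<subseteq> sphere 0 1"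
  shows "sphere_chart V \<psi>"
proof
  have "\<psi> ` V \<subseteq> topspace T"
    using assms(1) openin_subset by (auto simp: local_param_def)
  then show "\<psi> u \<in> sphere 0 1" if "u \<in> V" for u
    using assms(2) that by blast
qed (use assms(1) in \<open>auto simp: local_param_def\<close>)


subsection \<open>Topology of the submanifold and independence of the components\<close>

text \<open>\<open>T\<close> may be finer than the subspace topology, so continuity is glued from
  the chart images: these are open in \<open>T\<close>, and each chart is a homeomorphism onto its
  image.\<close>

lemma continuous_map_local_param:
  fixes g :: "real ^ 'n \<Rightarrow> 'b::topological_space"
  assumes T: "submanifold TYPE('m::finite) T"
    and g: "\<And>V (\<psi> :: real ^ 'm \<Rightarrow> real ^ 'n). local_param T V \<psi> \<Longrightarrow> continuous_on V (g \<circ> \<psi>)"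
  shows "continuous_map T euclidean g"
proof (rule pasting_lemma[where I = "{(V, \<psi> :: real ^ 'm \<Rightarrow> real ^ 'n). local_param T V \<psi>}"
      and T = "\<lambda>(V, \<psi>). \<psi> ` V" and f = "\<lambda>_. g"])
  fix c assume "c \<in> {(V, \<psi> :: real ^ 'm \<Rightarrow> real ^ 'n). local_param T V \<psi>}"
  then obtain V and \<psi> :: "real ^ 'm \<Rightarrow> real ^ 'n" where c: "c = (V, \<psi>)" "local_param T V \<psi>"
    by blast
  show "openin T (case c of (V, \<psi>) \<Rightarrow> \<psi> ` V)"
    using c by (simp add: local_param_def)
  have "quotient_map (top_of_set V) (subtopology T (\<psi> ` V)) \<psi>"
    using c by (simp add: local_param_def embedding_map_def homeomorphic_map_def)
  then show "continuous_map (subtopology T (case c of (V, \<psi>) \<Rightarrow> \<psi> ` V)) euclidean g"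
    using g[OF c(2)] c(1) continuous_compose_quotient_map_eq by fastforce
next
  fix x assume "x \<in> topspace T"
  then show "\<exists>c. c \<in> {(V, \<psi> :: real ^ 'm \<Rightarrow> real ^ 'n). local_param T V \<psi>} \<and>
      x \<in> (case c of (V, \<psi>) \<Rightarrow> \<psi> ` V) \<and> g x = g x"
    using T unfolding submanifold_def by fastforce
qed simp

lemma connected_space_finite_image_constant:
  fixes g :: "'a \<Rightarrow> 'b::metric_space"
  assumes T: "connected_space T" and g: "continuous_map T euclidean g" "finite (g ` topspace T)"
    and "p \<in> topspace T" "q \<in> topspace T"
  shows "g p = g q"
proof -
  have "connectedin euclidean (g ` topspace T)"
    using T by (intro connectedin_continuous_map_image[OF g(1)]) (simp add: connectedin_topspace)
  then have "connected (g ` topspace T)" by simp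
  then show ?thesis
    using connected_finite_iff_sing g(2) assms(4,5) by (metis empty_iff imageI singletonD)
qed

section \<open>Dimension count for independent subspaces\<close>

lemma span_Un_eq_sums:
  assumes "subspace A" "subspace B"
  shows "span (A \<union> B) = {x + y |x y. x \<in> A \<and> y \<in> B}"
proof -
  have "span A = A" "span B = B" using assms by (simp_all only: span_eq_iff)
  then show ?thesis unfolding span_Un by blast
qed

lemma dim_span_Union_le:
  fixes S :: "'i \<Rightarrow> 'a::euclidean_space set"
  assumes "finite I"
  shows "dim (span (\<Union>i\<in>I. span (S i))) \<le> (\<Sum>i\<in>I. dim (span (S i)))"
  using assms
proof induction
  case (insert j I)
  have "span (\<Union>i\<in>insert j I. span (S i)) = span (span (S j) \<union> span (\<Union>i\<in>I. span (S i)))"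
    by (simp add: span_Un span_span)
  also have "dim \<dots> \<le> dim (span (S j)) + dim (span (\<Union>i\<in>I. span (S i)))"
    using dim_sums_Int[OF subspace_span[of "S j"] subspace_span[of "\<Union>i\<in>I. span (S i)"]]
    unfolding span_Un_eq_sums[OF subspace_span subspace_span] by linarith
  finally show ?case using insert by simp
qed simp

text \<open>Split the span \<open>A\<close> of the chosen index from the span \<open>B\<close> of
  all the others. The dimension formula and subadditivity force \<open>A \<inter> B\<close> to be
  trivial, and the relation puts \<open>v j\<close> into both.\<close>

lemma dim_eq_sum_imp_independent:
  fixes S :: "'i \<Rightarrow> 'a::euclidean_space set"
  assumes I: "finite I"
    and dim: "dim (span (\<Union>i\<in>I. span (S i))) = (\<Sum>i\<in>I. dim (span (S i)))"
    and v: "\<And>i. i \<in> I \<Longrightarrow> v i \<in> span (S i)" "(\<Sum>i\<in>I. v i) = 0" and j: "j \<in> I"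
  shows "v j = 0"
proof -
  define A where "A = span (S j)"
  define B where "B = span (\<Union>i\<in>I - {j}. span (S i))"
  have AB: "subspace A" "subspace B" by (simp_all add: A_def B_def)
  have "(\<Union>i\<in>I. span (S i)) = span (S j) \<union> (\<Union>i\<in>I - {j}. span (S i))" using j by blast
  then have "span (\<Union>i\<in>I. span (S i)) = span (A \<union> B)"
    by (simp add: A_def B_def span_Un span_span)
  then have "(\<Sum>i\<in>I. dim (span (S i))) + dim (A \<inter> B) = dim A + dim B"
    using dim_sums_Int[OF AB] dim span_Un_eq_sums[OF AB] by simp
  moreover have "dim B \<le> (\<Sum>i\<in>I - {j}. dim (span (S i)))"
    unfolding B_def using I by (intro dim_span_Union_le) simp
  moreover have "(\<Sum>i\<in>I. dim (span (S i))) = dim A + (\<Sum>i\<in>I - {j}. dim (span (S i)))"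
    using I j by (simp add: sum.remove A_def)
  ultimately have "dim (A \<inter> B) = 0" by linarith
  then have "A \<inter> B \<subseteq> {0}" by (simp only: dim_eq_0)
  moreover have "v j = - (\<Sum>i\<in>I - {j}. v i)"
    using v(2) I j by (simp add: sum.remove eq_neg_iff_add_eq_0)
  then have "v j \<in> B"
    unfolding B_def using v(1) by (simp only:) (intro span_neg span_sum span_base, blast)
  moreover have "v j \<in> A" using v(1) j by (simp add: A_def)
  ultimately show ?thesis by blast
qed

text \<open>All values lie among the two roots \<open>b + sqrt a\<close> and
  \<open>b - sqrt a\<close>, which may coincide.\<close>

lemma card_squares_le_2:
  fixes a b :: real
  assumes "inj_on \<mu> I" "\<And>i. i \<in> I \<Longrightarrow> (\<mu> i - b)\<^sup>2 = a"
  shows "card I \<le> 2"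
proof -
  have "\<mu> ` I \<subseteq> {b + sqrt a, b - sqrt a}"
  proof (rule image_subsetI)
    fix i assume "i \<in> I"
    then have "sqrt a = \<bar>\<mu> i - b\<bar>" using assms(2) real_sqrt_abs by metis
    then have "\<mu> i = b + sqrt a \<or> \<mu> i = b - sqrt a" by linarith
    then show "\<mu> i \<in> {b + sqrt a, b - sqrt a}" by simp
  qed
  then have "card (\<mu> ` I) \<le> card {b + sqrt a, b - sqrt a}"
    by (rule card_mono[rotated]) simp
  also have "\<dots> \<le> 2"
    by (simp add: card_insert_if)
  finally show ?thesis
    using assms(1) by (simp add: card_image)
qed

section \<open>From the local equations to the number of eigenvalues\<close>

theorem proposition5p12:
  fixes T :: "(real ^ 'n) topology"
    and k :: nat
    and \<phi>\<^sub>0 :: "real ^ 'n"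
    and \<phi> :: "nat \<Rightarrow> real ^ 'n \<Rightarrow> real ^ 'n"
    and \<mu> :: "nat \<Rightarrow> real"
  assumes "sphere_submanifold TYPE('m::finite) T"
    and "proper_biharmonic TYPE('m) T"
    and "k_type_decomposition TYPE('m) T k \<phi>\<^sub>0 \<phi> \<mu>"
    and "mass_symmetric k \<phi>\<^sub>0 \<mu>"
    and "lin_indep_type T k \<phi>"
  shows "k = 2"
proof -
  define m where "m = real CARD('m)"
  define S where "S p = (\<Sum>i=1..k. (\<mu> i - m)\<^sup>2 *\<^sub>R \<phi> i p)" for p
  have sub: "submanifold TYPE('m) T" and sph: "topspace T \<subseteq> sphere 0 1"
    using assms(1) by (simp_all add: sphere_submanifold_def)
  have sum_phi: "p = (\<Sum>i=1..k. \<phi> i p)" if "p \<in> topspace T" for p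
    using assms(3,4) that unfolding k_type_decomposition_def mass_symmetric_def by auto
  have nonconst: "\<not> \<phi> i constant_on topspace T" and eig: "eigenmap TYPE('m) T (\<mu> i) (\<phi> i)"
    if "i \<in> {1..k}" for i
    using assms(3) that unfolding k_type_decomposition_def by auto
  have chart: "sphere_chart V \<psi>"
    and smooth_phi: "\<And>i. i \<in> {1..k} \<Longrightarrow> smooth V (\<phi> i \<circ> \<psi>)"
    and eigen: "\<And>i u. i \<in> {1..k} \<Longrightarrow> u \<in> V \<Longrightarrow> laplacian \<psi> (\<phi> i \<circ> \<psi>) u = \<mu> i *\<^sub>R (\<phi> i \<circ> \<psi>) u"
    and inT: "\<And>u. u \<in> V \<Longrightarrow> \<psi> u \<in> topspace T"
    and psi_sum: "\<And>u. u \<in> V \<Longrightarrow> \<psi> u = (\<Sum>i=1..k. (\<phi> i \<circ> \<psi>) u)"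
    if loc: "local_param T V \<psi>" for V and \<psi> :: "real ^ 'm \<Rightarrow> real ^ 'n"
  proof -
    show "sphere_chart V \<psi>" by (rule sphere_chart_local_param[OF loc sph])
    show "smooth V (\<phi> i \<circ> \<psi>)" if "i \<in> {1..k}" for i
      using eig[OF that] loc unfolding eigenmap_def smooth_map_on_def by blast
    show "laplacian \<psi> (\<phi> i \<circ> \<psi>) u = \<mu> i *\<^sub>R (\<phi> i \<circ> \<psi>) u" if "i \<in> {1..k}" "u \<in> V" for i u
      using eig[OF that(1)] loc that(2) unfolding eigenmap_def by auto
    show inT: "\<psi> u \<in> topspace T" if "u \<in> V" for u
      using loc that openin_subset unfolding local_param_def by blast
    show "\<psi> u = (\<Sum>i=1..k. (\<phi> i \<circ> \<psi>) u)" if "u \<in> V" for u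
      unfolding comp_apply by (rule sum_phi[OF inT[OF that]])
  qed
  \<comment> \<open>A point with nonzero H. It serves as base point for the constant
    \<open>a\<close> and later excludes k = 0 and k = 1.\<close>
  obtain V\<^sub>0 and \<psi>\<^sub>0 :: "real ^ 'm \<Rightarrow> real ^ 'n" and u\<^sub>0
    where loc0: "local_param T V\<^sub>0 \<psi>\<^sub>0" and u0: "u\<^sub>0 \<in> V\<^sub>0" "mean_curv \<psi>\<^sub>0 u\<^sub>0 \<noteq> 0"
    using assms(2) unfolding proper_biharmonic_def minimal_def by blast

  have tproj_S: "tproj p (S p) = 0" if "p \<in> topspace T" for p
  proof -
    have "\<exists>V. \<exists>\<psi> :: real ^ 'm \<Rightarrow> real ^ 'n. local_param T V \<psi> \<and> p \<in> \<psi> ` V"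
      using sub that by (simp add: submanifold_def)
    then obtain V and \<psi> :: "real ^ 'm \<Rightarrow> real ^ 'n" and u
      where loc: "local_param T V \<psi>" and u: "u \<in> V" "p = \<psi> u"
      by auto
    interpret sphere_chart V \<psi> by (rule chart[OF loc])
    have "rough_laplacian \<psi> (mean_curv \<psi>) u + metric_trace \<psi> u
        (\<lambda>i j. sphere_curv (\<psi> u) (pd i \<psi> u) (mean_curv \<psi> u) (pd j \<psi> u)) = 0"
      using assms(2) loc u(1) unfolding proper_biharmonic_def biharmonic_def by blast
    from biharmonic_eigen[OF smooth_phi[OF loc] eigen[OF loc] psi_sum[OF loc] u(1) this]
    show ?thesis by (simp add: S_def u(2) m_def)
  qed
  have S: "(\<mu> i - m)\<^sup>2 = p \<bullet> S p" if p: "p \<in> topspace T" and i: "i \<in> {1..k}" "\<phi> i p \<noteq> 0" for p i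
  proof -
    \<comment> \<open>\<open>S p\<close> is radial, so it equals
      \<open>(p \<bullet> S p) *\<^sub>R p\<close>. Expanding the last \<open>p\<close> into its
      components gives one vanishing combination, to which independence applies.\<close>
    have "(\<Sum>i=1..k. ((\<mu> i - m)\<^sup>2 - p \<bullet> S p) *\<^sub>R \<phi> i p) = S p - (p \<bullet> S p) *\<^sub>R (\<Sum>i=1..k. \<phi> i p)"
      by (simp add: S_def scaleR_diff_left sum_subtractf scaleR_sum_right)
    also have "\<dots> = 0"
      unfolding sum_phi[OF p, symmetric] using tproj_S[OF p] by (simp add: tproj_def)
    finally have "(\<Sum>i=1..k. ((\<mu> i - m)\<^sup>2 - p \<bullet> S p) *\<^sub>R \<phi> i p) = 0" .
    then have "((\<mu> i - m)\<^sup>2 - p \<bullet> S p) *\<^sub>R \<phi> i p = 0"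
      using dim_eq_sum_imp_independent[OF _ assms(5)[unfolded lin_indep_type_def],
          of "\<lambda>i. ((\<mu> i - m)\<^sup>2 - p \<bullet> S p) *\<^sub>R \<phi> i p" i] p i(1)
      by (simp add: span_base span_scale)
    then show ?thesis using i(2) by simp
  qed
  have cont: "continuous_map T euclidean (\<lambda>p. p \<bullet> S p)"
  proof (rule continuous_map_local_param[OF sub])
    fix V and \<psi> :: "real ^ 'm \<Rightarrow> real ^ 'n" assume loc: "local_param T V \<psi>"
    have "continuous_on V f" if "smooth V f" for f :: "real ^ 'm \<Rightarrow> real ^ 'n"
      using smoothD[OF that] by (meson continuous_at_imp_continuous_on differentiable_imp_continuous_within)
    then have "continuous_on V \<psi>" "\<And>i. i \<in> {1..k} \<Longrightarrow> continuous_on V (\<lambda>u. \<phi> i (\<psi> u))"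
      using loc smooth_phi[OF loc] by (auto simp: local_param_def comp_def)
    then show "continuous_on V ((\<lambda>p. p \<bullet> S p) \<circ> \<psi>)"
      unfolding S_def comp_def by (intro continuous_intros)
  qed
  \<comment> \<open>Points of the sphere are nonzero, so at each of them some component is nonzero
    and \<open>S\<close> fixes the value.\<close>
  have "(\<lambda>p. p \<bullet> S p) ` topspace T \<subseteq> (\<lambda>i. (\<mu> i - m)\<^sup>2) ` {1..k}"
  proof clarify
    fix p assume p: "p \<in> topspace T"
    then have "p \<noteq> 0" using sph by auto
    then obtain i where "i \<in> {1..k}" "\<phi> i p \<noteq> 0"
      using sum_phi[OF p] by (metis sum.neutral)
    with S[OF p] show "p \<bullet> S p \<in> (\<lambda>i. (\<mu> i - m)\<^sup>2) ` {1..k}" by force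
  qed
  then have fin: "finite ((\<lambda>p. p \<bullet> S p) ` topspace T)"
    by (rule finite_subset) simp
  have const: "p \<bullet> S p = q \<bullet> S q" if "p \<in> topspace T" "q \<in> topspace T" for p q
  proof (rule connected_space_finite_image_constant[OF _ cont fin that])
    show "connected_space T" using sub by (simp add: submanifold_def)
  qed
  define a where "a = \<psi>\<^sub>0 u\<^sub>0 \<bullet> S (\<psi>\<^sub>0 u\<^sub>0)"
  have "(\<mu> i - m)\<^sup>2 = a" if i: "i \<in> {1..k}" for i
  proof -
    \<comment> \<open>A component vanishing on all of M would be constant.\<close>
    obtain p where p: "p \<in> topspace T" "\<phi> i p \<noteq> 0"
      using nonconst[OF i] by (auto simp: constant_on_def)
    show ?thesis
      unfolding S[OF p(1) i p(2)] a_def by (rule const[OF p(1) inT[OF loc0 u0(1)]])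
  qed
  moreover have "inj_on \<mu> {1..k}"
    using assms(3) by (simp add: k_type_decomposition_def)
  ultimately have "k \<le> 2"
    using card_squares_le_2[of \<mu> "{1..k}" m a] by simp

  interpret C: sphere_chart V\<^sub>0 \<psi>\<^sub>0 by (rule chart[OF loc0])
  note sum0 = psi_sum[OF loc0 u0(1)]
  have H: "mean_curv \<psi>\<^sub>0 u\<^sub>0 = (\<Sum>i=1..k. (1 - \<mu> i / m) *\<^sub>R (\<phi> i \<circ> \<psi>\<^sub>0) u\<^sub>0)"
    unfolding m_def
    by (rule C.mean_curv_eigen[OF smooth_phi[OF loc0] eigen[OF loc0] psi_sum[OF loc0] u0(1)])
  have "k \<noteq> 0"
  proof
    assume "k = 0"
    then show False using H u0(2) by simp
  qed
  \<comment> \<open>With a single component, H is a multiple of the unit position vector, to which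
    it is also orthogonal.\<close>
  moreover have "k \<noteq> 1"
  proof
    assume "k = 1"
    then have "mean_curv \<psi>\<^sub>0 u\<^sub>0 = (1 - \<mu> 1 / m) *\<^sub>R (\<Sum>i=1..k. (\<phi> i \<circ> \<psi>\<^sub>0) u\<^sub>0)"
      using H by simp
    then have "mean_curv \<psi>\<^sub>0 u\<^sub>0 = (1 - \<mu> 1 / m) *\<^sub>R \<psi>\<^sub>0 u\<^sub>0"
      unfolding sum0[symmetric] .
    then show False
      using C.mean_curv_orthogonal(2)[OF u0(1)] C.inner_self[OF u0(1)] u0(2) by simp
  qed
  ultimately show "k = 2"
    using \<open>k \<le> 2\<close> by linarith
qed

end
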